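(* A groupoid $S$ is an AG-group if and only if $S$ is a left simple, completely inverse AG**-groupoid.
   Context: A groupoid is a nonempty set with a binary operation. An AG-groupoid is a groupoid satisfying $(xy)z=(zy)x$; an AG**-groupoid is an AG-groupoid that also satisfies $x(yz)=y(xz)$. An AG-group is an AG-groupoid with a left identity $e$ (i.e. $ex=x$ for all $x$) in which for every element $a$ there exists an element $a^*$ with $a^*a=e$. In a groupoid, $b$ is an inverse of $a$ if $(ab)a=a$ and $(ba)b=b$. A groupoid is completely inverse if every element $a$ has a unique inverse $a^{-1}$ and $aa^{-1}=a^{-1}a$. A left ideal of a groupoid $S$ is a subset $I\subseteq S$ with $SI\subseteq I$; $S$ is left simple if its only nonempty left ideal is $S$ itself. *)

theory Defs
  imports Main
begin

text \<open>A groupoid (magma) is given by a nonempty carrier set and an operation that is closed on it;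
  all laws are relativised to the carrier.\<close>

locale groupoid =
  fixes S :: "'a set" and mult :: "'a \<Rightarrow> 'a \<Rightarrow> 'a"  (infixl "\<cdot>" 70)
  assumes nonempty: "S \<noteq> {}"
    and closed: "\<And>x y. x \<in> S \<Longrightarrow> y \<in> S \<Longrightarrow> x \<cdot> y \<in> S"
begin

definition is_inverse :: "'a \<Rightarrow> 'a \<Rightarrow> bool" where
  "is_inverse a b \<longleftrightarrow> a \<in> S \<and> b \<in> S \<and> (a \<cdot> b) \<cdot> a = a \<and> (b \<cdot> a) \<cdot> b = b"

definition left_ideal :: "'a set \<Rightarrow> bool" where
  "left_ideal I \<longleftrightarrow> I \<subseteq> S \<and> (\<forall>s\<in>S. \<forall>x\<in>I. s \<cdot> x \<in> I)"

end

locale ag_groupoid = groupoid +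
  assumes left_invertive:
    "\<And>x y z. x \<in> S \<Longrightarrow> y \<in> S \<Longrightarrow> z \<in> S \<Longrightarrow> (x \<cdot> y) \<cdot> z = (z \<cdot> y) \<cdot> x"

locale ag_star_star_groupoid = ag_groupoid +
  assumes left_permutable:
    "\<And>x y z. x \<in> S \<Longrightarrow> y \<in> S \<Longrightarrow> z \<in> S \<Longrightarrow> x \<cdot> (y \<cdot> z) = y \<cdot> (x \<cdot> z)"

locale ag_group = ag_groupoid +
  assumes left_identity_and_left_inverses:
    "\<exists>e\<in>S. (\<forall>x\<in>S. e \<cdot> x = x) \<and> (\<forall>a\<in>S. \<exists>a'\<in>S. a' \<cdot> a = e)"

locale completely_inverse_groupoid = groupoid +
  assumes unique_inverse: "\<And>a. a \<in> S \<Longrightarrow> \<exists>!b. is_inverse a b"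
    and inverse_commutes: "\<And>a b. a \<in> S \<Longrightarrow> is_inverse a b \<Longrightarrow> a \<cdot> b = b \<cdot> a"

locale left_simple_groupoid = groupoid +
  assumes left_simple: "\<And>I. left_ideal I \<Longrightarrow> I \<noteq> {} \<Longrightarrow> I = S"

end

theory Submission
  imports Defs
begin

text \<open>Both directions come down to how a left identity arises and what it does.

  In an AG-groupoid with a left identity \<open>e\<close>, the left invertive law gives
  \<open>x \<cdot> y = (e \<cdot> x) \<cdot> y = (y \<cdot> x) \<cdot> e\<close>, so a left inverse is also a right inverse, and
  \<open>(x \<cdot> a) \<cdot> a\<^sup>* = (a\<^sup>* \<cdot> a) \<cdot> x = x\<close>, so right cancellation holds. By cancellation the equation
  \<open>(b \<cdot> a) \<cdot> b = b = e \<cdot> b\<close> forces \<open>b \<cdot> a = e\<close>, so that the inverses of \<open>a\<close> are exactly its left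
  inverses, and there is only one. A nonempty left ideal contains some \<open>x\<close>, hence
  \<open>x\<^sup>* \<cdot> x = e\<close>, hence every \<open>s = (s \<cdot> e) \<cdot> e\<close>. The AG** law is the medial law
  \<open>(a \<cdot> b) \<cdot> (c \<cdot> d) = (a \<cdot> c) \<cdot> (b \<cdot> d)\<close> with \<open>a = e\<close>.

  Conversely, in an AG**-groupoid every idempotent \<open>e\<close> generates the left ideal \<open>S \<cdot> e\<close>, on which
  \<open>e\<close> acts as a left identity. If \<open>S\<close> is left simple this ideal is \<open>S\<close>, so every idempotent is a
  left identity; and an AG-groupoid has at most one left identity. In the completely inverse case
  all products \<open>a\<inverse> \<cdot> a\<close> are idempotent, so they all equal this single left identity.\<close>

section \<open>AG-groupoids\<close>

context ag_groupoid
begin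

lemma medial:
  assumes "a \<in> S" "b \<in> S" "c \<in> S" "d \<in> S"
  shows "(a \<cdot> b) \<cdot> (c \<cdot> d) = (a \<cdot> c) \<cdot> (b \<cdot> d)"
proof -
  have "(a \<cdot> b) \<cdot> (c \<cdot> d) = ((c \<cdot> d) \<cdot> b) \<cdot> a"
    using assms by (intro left_invertive closed)
  also have "\<dots> = ((b \<cdot> d) \<cdot> c) \<cdot> a"
    using left_invertive[of c d b] assms by simp
  also have "\<dots> = (a \<cdot> c) \<cdot> (b \<cdot> d)"
    using assms by (intro left_invertive closed)
  finally show ?thesis .
qed

lemma left_identity_unique:
  assumes "e \<in> S" "f \<in> S" "\<forall>x\<in>S. e \<cdot> x = x" "\<forall>x\<in>S. f \<cdot> x = x"
  shows "e = f"
proof -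
  have "f = (e \<cdot> e) \<cdot> f" using assms by simp
  also have "\<dots> = (f \<cdot> e) \<cdot> e" using assms by (intro left_invertive)
  also have "\<dots> = e" using assms by simp
  finally show ?thesis by simp
qed

text \<open>The two factors \<open>ab\<close> and \<open>ba\<close> of \<open>(ba)(ab) = ((ab)a)b\<close> coincide, and \<open>(ab)a = a\<close>.\<close>

lemma commuting_inverse_product_idempotent:
  assumes "is_inverse a b" "a \<cdot> b = b \<cdot> a"
  shows "(b \<cdot> a) \<cdot> (b \<cdot> a) = b \<cdot> a"
proof -
  have S: "a \<in> S" "b \<in> S" and aba: "(a \<cdot> b) \<cdot> a = a"
    using assms(1) by (auto simp: is_inverse_def)
  have "(b \<cdot> a) \<cdot> (a \<cdot> b) = ((a \<cdot> b) \<cdot> a) \<cdot> b"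
    using S by (intro left_invertive) (auto intro: closed)
  then show ?thesis using aba assms(2) by simp
qed

end

section \<open>From AG-groups to left simple, completely inverse AG**-groupoids\<close>

lemma (in ag_groupoid) left_identity_imp_left_permutable:
  assumes e: "e \<in> S" "\<forall>x\<in>S. e \<cdot> x = x"
    and xyz: "x \<in> S" "y \<in> S" "z \<in> S"
  shows "x \<cdot> (y \<cdot> z) = y \<cdot> (x \<cdot> z)"
  using medial[of e x y z] assms by simp

context ag_group
begin

lemma right_cancel:
  assumes "x \<in> S" "y \<in> S" "a \<in> S" "x \<cdot> a = y \<cdot> a"
  shows "x = y"
proof -
  obtain e where e: "e \<in> S" "\<forall>x\<in>S. e \<cdot> x = x"
    and inv: "\<forall>a\<in>S. \<exists>a'\<in>S. a' \<cdot> a = e"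
    using left_identity_and_left_inverses by blast
  obtain a' where a': "a' \<in> S" "a' \<cdot> a = e" using inv assms(3) by blast
  have undo: "(z \<cdot> a) \<cdot> a' = z" if "z \<in> S" for z
    using left_invertive[of z a a'] that assms(3) a' e by simp
  show ?thesis using undo[OF assms(1)] undo[OF assms(2)] unfolding assms(4) by (rule trans[OF sym])
qed

text \<open>A left inverse is two-sided because \<open>a a' = (e a) a' = (a' a) e = e\<close>, so it is an inverse;
  conversely \<open>b\<close> can be cancelled from \<open>(b a) b = b = e b\<close>.\<close>

lemma is_inverse_iff_left_inverse:
  assumes e: "e \<in> S" "\<forall>x\<in>S. e \<cdot> x = x" and S: "a \<in> S" "b \<in> S"
  shows "is_inverse a b \<longleftrightarrow> b \<cdot> a = e"
    and "b \<cdot> a = e \<Longrightarrow> a \<cdot> b = e"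
proof -
  show two_sided: "a \<cdot> b = e" if "b \<cdot> a = e"
    using left_invertive[of e a b] that e S by simp
  show "is_inverse a b \<longleftrightarrow> b \<cdot> a = e"
  proof
    assume "is_inverse a b"
    then have "(b \<cdot> a) \<cdot> b = e \<cdot> b" using e S by (simp add: is_inverse_def)
    then show "b \<cdot> a = e" using right_cancel[of "b \<cdot> a" e b] e S by (simp add: closed)
  next
    assume "b \<cdot> a = e"
    then show "is_inverse a b" using two_sided e S by (simp add: is_inverse_def)
  qed
qed

lemma completely_inverse: "completely_inverse_groupoid S mult"
proof -
  obtain e where e: "e \<in> S" "\<forall>x\<in>S. e \<cdot> x = x"
    and inv: "\<forall>a\<in>S. \<exists>a'\<in>S. a' \<cdot> a = e"
    using left_identity_and_left_inverses by blast
  show ?thesis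
  proof
    fix a assume a: "a \<in> S"
    obtain b where b: "b \<in> S" "b \<cdot> a = e" using inv a by blast
    show "\<exists>!b. is_inverse a b"
    proof
      show "is_inverse a b" using is_inverse_iff_left_inverse(1)[OF e a b(1)] b by simp
    next
      fix c assume c: "is_inverse a c"
      then have "c \<in> S" by (simp add: is_inverse_def)
      then have "c \<cdot> a = b \<cdot> a" using is_inverse_iff_left_inverse(1)[OF e a] c b by simp
      then show "c = b" using right_cancel \<open>c \<in> S\<close> b a by blast
    qed
  next
    fix a b assume a: "a \<in> S" and ab: "is_inverse a b"
    then have "b \<in> S" by (simp add: is_inverse_def)
    then show "a \<cdot> b = b \<cdot> a" using is_inverse_iff_left_inverse[OF e a] ab by simp
  qed
qed

lemma left_simple: "left_simple_groupoid S mult"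
proof
  fix I assume I: "left_ideal I" "I \<noteq> {}"
  obtain e where e: "e \<in> S" "\<forall>x\<in>S. e \<cdot> x = x"
    and inv: "\<forall>a\<in>S. \<exists>a'\<in>S. a' \<cdot> a = e"
    using left_identity_and_left_inverses by blast
  have sub: "I \<subseteq> S" and absorb: "\<And>s x. s \<in> S \<Longrightarrow> x \<in> I \<Longrightarrow> s \<cdot> x \<in> I"
    using I(1) by (auto simp: left_ideal_def)
  obtain x where x: "x \<in> I" using I(2) by blast
  obtain x' where "x' \<in> S" "x' \<cdot> x = e" using inv x sub by blast
  then have eI: "e \<in> I" using absorb x by metis
  have "s \<in> I" if "s \<in> S" for s
  proof -
    have "(s \<cdot> e) \<cdot> e = s" using left_invertive[of s e e] that e by simp
    then show ?thesis using absorb[OF closed[OF that e(1)] eI] by simp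
  qed
  then show "I = S" using sub by blast
qed

lemma ag_star_star: "ag_star_star_groupoid S mult"
proof -
  obtain e where e: "e \<in> S" "\<forall>x\<in>S. e \<cdot> x = x"
    using left_identity_and_left_inverses by blast
  show ?thesis by unfold_locales (rule left_identity_imp_left_permutable[OF e])
qed

end

section \<open>Idempotents in AG**-groupoids\<close>

context ag_star_star_groupoid
begin

lemma idempotent_left_identity_on_multiples:
  assumes "e \<in> S" "e \<cdot> e = e" "t \<in> S"
  shows "e \<cdot> (t \<cdot> e) = t \<cdot> e"
  using left_permutable[of e t e] assms by simp

text \<open>An element \<open>x = s(te)\<close> satisfies \<open>ex = s(e(te)) = x\<close>, and
  \<open>ex = (ee)x = (xe)e\<close> lies in \<open>Se\<close> by the left invertive law.\<close>

lemma left_ideal_of_idempotent: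
  assumes e: "e \<in> S" "e \<cdot> e = e"
  shows "left_ideal ((\<lambda>t. t \<cdot> e) ` S)"
proof -
  have "s \<cdot> (t \<cdot> e) \<in> (\<lambda>t. t \<cdot> e) ` S" if st: "s \<in> S" "t \<in> S" for s t
  proof -
    let ?x = "s \<cdot> (t \<cdot> e)"
    have x: "?x \<in> S" using st e by (simp add: closed)
    have "?x = e \<cdot> ?x"
      using left_permutable[of e s "t \<cdot> e"] idempotent_left_identity_on_multiples[OF e st(2)] st e
      by (simp add: closed)
    also have "\<dots> = (?x \<cdot> e) \<cdot> e"
      using left_invertive[of e e ?x] e x by simp
    finally show ?thesis using closed[OF x e(1)] by (rule image_eqI)
  qed
  then show ?thesis using e by (auto simp: left_ideal_def closed)
qed

lemma left_simple_imp_idempotent_left_identity: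
  assumes ls: "left_simple_groupoid S mult"
    and e: "e \<in> S" "e \<cdot> e = e" and "x \<in> S"
  shows "e \<cdot> x = x"
proof -
  have "(\<lambda>t. t \<cdot> e) ` S = S"
    using left_simple_groupoid.left_simple[OF ls left_ideal_of_idempotent[OF e]] e by blast
  then obtain t where "t \<in> S" "x = t \<cdot> e" using \<open>x \<in> S\<close> by blast
  then show ?thesis using idempotent_left_identity_on_multiples[OF e] by simp
qed

text \<open>Each element \<open>a\<close> has an inverse \<open>b\<close> commuting with it, so \<open>ba\<close> is idempotent and hence a left
  identity. Uniqueness of left identities makes \<open>ba\<close> independent of \<open>a\<close>.\<close>

lemma left_simple_completely_inverse_imp_ag_group:
  assumes ls: "left_simple_groupoid S mult"
    and inv: "completely_inverse_groupoid S mult"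
  shows "ag_group S mult"
proof -
  have local_identity: "\<exists>b\<in>S. b \<cdot> a \<in> S \<and> (\<forall>x\<in>S. (b \<cdot> a) \<cdot> x = x)" if a: "a \<in> S" for a
  proof -
    obtain b where b: "is_inverse a b"
      using completely_inverse_groupoid.unique_inverse[OF inv a] by blast
    have "(b \<cdot> a) \<cdot> (b \<cdot> a) = b \<cdot> a"
      using commuting_inverse_product_idempotent[OF b]
        completely_inverse_groupoid.inverse_commutes[OF inv a b] by blast
    moreover have "b \<in> S" using b by (simp add: is_inverse_def)
    ultimately show ?thesis
      using left_simple_imp_idempotent_left_identity[OF ls, of "b \<cdot> a"] a closed by blast
  qed
  obtain e where e: "e \<in> S" "\<forall>x\<in>S. e \<cdot> x = x"
    using nonempty local_identity by blast
  have "\<exists>b\<in>S. b \<cdot> a = e" if a: "a \<in> S" for a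
  proof -
    obtain b where b: "b \<in> S" "b \<cdot> a \<in> S" "\<forall>x\<in>S. (b \<cdot> a) \<cdot> x = x"
      using local_identity[OF a] by blast
    have "b \<cdot> a = e" using b e by (intro left_identity_unique) auto
    then show ?thesis using b(1) by blast
  qed
  then have "\<exists>e\<in>S. (\<forall>x\<in>S. e \<cdot> x = x) \<and> (\<forall>a\<in>S. \<exists>a'\<in>S. a' \<cdot> a = e)"
    using e by (intro bexI[of _ e]) auto
  then show ?thesis by unfold_locales
qed

end

section \<open>AG-groups characterised by left simplicity and inverses\<close>

theorem theorem8:
  fixes S :: "'a set" and mult :: "'a \<Rightarrow> 'a \<Rightarrow> 'a"
  assumes "groupoid S mult"
  shows "ag_group S mult \<longleftrightarrow>
    left_simple_groupoid S mult \<and> completely_inverse_groupoid S mult \<and>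
    ag_star_star_groupoid S mult"
  using ag_group.left_simple ag_group.completely_inverse ag_group.ag_star_star
    ag_star_star_groupoid.left_simple_completely_inverse_imp_ag_group
  by blast

end
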